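(* There is a set $X \subseteq \omega^{\uparrow\omega}$ with $X \in m^0$ and $X \notin t^0$, i.e. $m^0 \setminus t^0 \neq \emptyset$.
   Context: $\omega^{\uparrow<\omega}$ denotes the set of strictly increasing finite sequences of natural numbers and $\omega^{\uparrow\omega}$ the set of strictly increasing infinite sequences (identified with infinite subsets of $\omega$ via increasing enumeration). A tree is a nonempty subset $T\subseteq\omega^{\uparrow<\omega}$ closed under initial segments; $[T]$ is its set of infinite branches in $\omega^{\uparrow\omega}$. For a family $\mathbb P$ of trees, the associated ideal consists of all $X\subseteq\omega^{\uparrow\omega}$ such that for every $T\in\mathbb P$ there is $T'\in\mathbb P$ with $T'\subseteq T$ and $[T']\cap X=\emptyset$. A Miller tree is a tree $T$ such that every node of $T$ has an extension in $T$ with infinitely many immediate successors in $T$; $m^0$ is the ideal associated with Miller trees. A Matet tree is determined by a finite set $s\subseteq\omega$ and a sequence $\{a_n;n\in\omega\}$ of nonempty finite subsets of $\omega$ with $\max s<\min a_0$ and $\max a_n<\min a_{n+1}$; it is the tree of all finite initial segments of increasing enumerations of sets $s\cup\bigcup_{n\in B}a_n$ with $B\subseteq\omega$ infinite; $t^0$ is the ideal associated with Matet trees. *)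

theory Defs
  imports Main "HOL-Library.Infinite_Set" "HOL-Library.Sublist"
begin

definition fin_incr_seqs :: "nat list set" where
  "fin_incr_seqs = {t. sorted_wrt (<) t}"

definition inf_incr_seqs :: "(nat \<Rightarrow> nat) set" where
  "inf_incr_seqs = {f. strict_mono f}"

definition is_tree :: "nat list set \<Rightarrow> bool" where
  "is_tree T \<longleftrightarrow> T \<noteq> {} \<and> T \<subseteq> fin_incr_seqs \<and> (\<forall>t\<in>T. \<forall>u. prefix u t \<longrightarrow> u \<in> T)"

definition init_seg :: "(nat \<Rightarrow> nat) \<Rightarrow> nat \<Rightarrow> nat list" where
  "init_seg f k = map f [0..<k]"

definition branches :: "nat list set \<Rightarrow> (nat \<Rightarrow> nat) set" where
  "branches T = {f \<in> inf_incr_seqs. \<forall>k. init_seg f k \<in> T}"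

definition tree_ideal :: "nat list set set \<Rightarrow> (nat \<Rightarrow> nat) set set" where
  "tree_ideal P = {X. X \<subseteq> inf_incr_seqs \<and>
     (\<forall>T\<in>P. \<exists>T'\<in>P. T' \<subseteq> T \<and> branches T' \<inter> X = {})}"

definition miller_trees :: "nat list set set" where
  "miller_trees = {T. is_tree T \<and>
     (\<forall>t\<in>T. \<exists>u\<in>T. prefix t u \<and> infinite {n. u @ [n] \<in> T})}"

(* s may be empty; the condition max s < min (a 0) is then vacuous. *)
definition matet_data :: "nat set \<Rightarrow> (nat \<Rightarrow> nat set) \<Rightarrow> bool" where
  "matet_data s a \<longleftrightarrow> finite s \<and> (\<forall>n. finite (a n) \<and> a n \<noteq> {}) \<and>
     (s \<noteq> {} \<longrightarrow> Max s < Min (a 0)) \<and> (\<forall>n. Max (a n) < Min (a (Suc n)))"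

(* For an infinite set A of naturals, enumerate A is its increasing enumeration. *)
definition matet_tree :: "nat set \<Rightarrow> (nat \<Rightarrow> nat set) \<Rightarrow> nat list set" where
  "matet_tree s a = {init_seg (enumerate (s \<union> (\<Union>n\<in>B. a n))) k | k B. infinite B}"

definition matet_trees :: "nat list set set" where
  "matet_trees = {matet_tree s a | s a. matet_data s a}"

definition m0 :: "(nat \<Rightarrow> nat) set set" where
  "m0 = tree_ideal miller_trees"

definition t0 :: "(nat \<Rightarrow> nat) set set" where
  "t0 = tree_ideal matet_trees"

end

theory Submission
  imports Defs "HOL-Library.Countable" "HOL-Library.Nat_Bijection"
begin

text \<open>
  Every Matet tree has continuum many branches that pairwise meet in an infinite set: let all
  even blocks be used and vary the odd ones. Every Miller tree \<open>S\<close> can be thinned out so that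
  distinct branches have almost disjoint ranges, by taking each new splitting successor larger
  than all numbers used before; in fact it has continuum many such Miller subtrees
  \<open>Q S z\<close> with pairwise disjoint branch sets. So each \<open>Q S z\<close> contains at most one of the
  chosen branches of a Matet tree, and a Bernstein-type recursion of length continuum picks one
  chosen branch for every Matet tree and one \<open>z\<close> for every Miller tree \<open>S\<close> such that no
  picked branch is a branch of a picked \<open>Q S z\<close>.
\<close>

unbundle cardinal_syntax

section \<open>A Bernstein-type recursion\<close>

text \<open>Each \<open>y\<close> rules out at most one \<open>w\<close>, so a set \<open>Y\<close>
  smaller than the type \<open>'i\<close> cannot rule out every \<open>w\<close>.\<close>

lemma ex_unrelated:
  fixes r :: "'b \<Rightarrow> 'i \<Rightarrow> bool" and Y :: "'b set"
  assumes small: "|Y| <o |UNIV :: 'i set|"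
    and uniq: "\<And>y w w'. y \<in> Y \<Longrightarrow> r y w \<Longrightarrow> r y w' \<Longrightarrow> w = w'"
  shows "\<exists>w. \<forall>y\<in>Y. \<not> r y w"
proof (rule ccontr)
  assume "\<not> ?thesis"
  then have *: "\<exists>y\<in>Y. r y w" for w by blast
  have "UNIV \<subseteq> (\<lambda>y. THE w. r y w) ` Y"
  proof
    fix w
    obtain y where y: "y \<in> Y" "r y w" using * by blast
    then have "(THE w. r y w) = w" using uniq by blast
    then show "w \<in> (\<lambda>y. THE w. r y w) ` Y" using y by (metis imageI)
  qed
  then have "|UNIV :: 'i set| \<le>o |(\<lambda>y. THE w. r y w) ` Y|" by (rule card_of_mono1)
  also have "|(\<lambda>y. THE w. r y w) ` Y| \<le>o |Y|" by (rule card_of_image)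
  finally show False using small not_ordLess_ordLeq by blast
qed

text \<open>Indices and parameters share the type \<open>'i\<close>, so along a well-order of
  minimal length every stage has fewer predecessors than available parameters. By
  \<open>once\<close> each earlier set blocks at most one choice of the new point; by
  \<open>disj\<close> each point chosen so far blocks at most one choice of the new set.\<close>

lemma bernstein_recursion:
  fixes p :: "'i \<Rightarrow> 'i \<Rightarrow> 'a" and Q :: "'i \<Rightarrow> 'i \<Rightarrow> 'a set"
  assumes inf: "infinite (UNIV :: 'i set)"
    and disj: "\<And>j z z'. j \<in> B \<Longrightarrow> z \<noteq> z' \<Longrightarrow> Q j z \<inter> Q j z' = {}"
    and once: "\<And>i j z w w'. i \<in> A \<Longrightarrow> j \<in> B \<Longrightarrow> p i w \<in> Q j z \<Longrightarrow> p i w' \<in> Q j z \<Longrightarrow> w = w'"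
  shows "\<exists>c. \<forall>j\<in>B. \<exists>z. \<forall>i\<in>A. p i (c i) \<notin> Q j z"
proof -
  define r where "r = |UNIV :: 'i set|"
  have card: "Card_order r" unfolding r_def by (rule card_of_Card_order)
  have fld: "Field r = UNIV" unfolding r_def by (rule Field_card_of)
  have wo: "Well_order r" using card by (rule card_order_on_well_order_on)
  have wf: "wf (r - Id)" using wo fld by (simp add: well_order_on_def)
  \<comment> \<open>Proper initial segments of a cardinal order are smaller than its field; as the
    type is infinite, adding \<open>i\<close> itself keeps this.\<close>
  have small: "|insert i (underS r i)| <o r" for i
  proof -
    have "|underS r i| <o r" using card fld card_of_underS by fastforce
    moreover have "|{i}| <o r" unfolding r_def using inf
      by (meson card_of_ordLeq_finite finite.emptyI finite.insertI
          card_of_Well_order not_ordLeq_iff_ordLess)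
    ultimately have "|{i} \<union> underS r i| <o r"
      using inf unfolding r_def by (intro card_of_Un_ordLess_infinite)
    then show ?thesis by simp
  qed
  \<comment> \<open>The first component of \<open>f i\<close> selects the point for
    \<open>i \<in> A\<close>, the second the set for \<open>i \<in> B\<close>. Each stage excludes
    conflicts with earlier stages and, last, the conflict of \<open>i\<close> with itself.\<close>
  define R where "R f i wz \<longleftrightarrow>
      (i \<in> A \<longrightarrow> (\<forall>j\<in>B \<inter> underS r i. p i (fst wz) \<notin> Q j (snd (f j)))) \<and>
      (i \<in> B \<longrightarrow> (\<forall>k\<in>A \<inter> underS r i. p k (fst (f k)) \<notin> Q i (snd wz)) \<and>
                 (i \<in> A \<longrightarrow> p i (fst wz) \<notin> Q i (snd wz)))"
    for f :: "'i \<Rightarrow> 'i \<times> 'i" and i wz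
  have "\<exists>f. \<forall>i. R f i (f i)"
  proof (rule dependent_wf_choice[OF wf])
    fix f g :: "'i \<Rightarrow> 'i \<times> 'i" and i wz
    assume "\<And>j. (j, i) \<in> r - Id \<Longrightarrow> f j = g j"
    then have "f j = g j" if "j \<in> underS r i" for j using that by (simp add: underS_def)
    then show "R f i wz = R g i wz" by (auto simp: R_def)
  next
    fix i and f :: "'i \<Rightarrow> 'i \<times> 'i"
    have "|B \<inter> underS r i| \<le>o |insert i (underS r i)|" by (intro card_of_mono1) auto
    then have "|B \<inter> underS r i| <o |UNIV :: 'i set|"
      using small[of i] ordLeq_ordLess_trans unfolding r_def by blast
    then have "\<exists>w. \<forall>j\<in>B \<inter> underS r i. \<not> (i \<in> A \<and> p i w \<in> Q j (snd (f j)))"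
      by (rule ex_unrelated) (use once in blast)
    then obtain w where w: "\<And>j. j \<in> B \<inter> underS r i \<Longrightarrow> i \<in> A \<Longrightarrow> p i w \<notin> Q j (snd (f j))"
      by blast
    \<comment> \<open>The value of \<open>f\<close> at \<open>i\<close> is still to be found, so the
      point for \<open>i\<close> is given by the new \<open>w\<close>; \<open>z\<close> has to avoid
      it along with the earlier points.\<close>
    let ?x = "\<lambda>k. p k (if k = i then w else fst (f k))"
    have "\<exists>z. \<forall>k\<in>insert i (underS r i). \<not> (i \<in> B \<and> ?x k \<in> Q i z)"
      by (rule ex_unrelated) (use small[of i] disj in \<open>auto simp: r_def\<close>)
    then obtain z where z: "\<And>k. k \<in> insert i (underS r i) \<Longrightarrow> i \<in> B \<Longrightarrow> ?x k \<notin> Q i z"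
      by blast
    have "p k (fst (f k)) \<notin> Q i z" if "k \<in> underS r i" "i \<in> B" for k
      using z[of k] that by (auto simp: underS_def)
    moreover have "p i w \<notin> Q i z" if "i \<in> B" using z[of i] that by simp
    ultimately have "R f i (w, z)" using w by (auto simp: R_def)
    then show "\<exists>wz. R f i wz" ..
  qed
  then obtain f where f: "\<And>i. R f i (f i)" by blast
  \<comment> \<open>The later of the two stages has excluded the conflict.\<close>
  have "p i (fst (f i)) \<notin> Q j (snd (f j))" if "i \<in> A" "j \<in> B" for i j
  proof -
    have "total r" using wo fld by (simp add: well_order_on_def linear_order_on_def)
    then consider "i = j" | "i \<in> underS r j" | "j \<in> underS r i"
      unfolding total_on_def underS_def by auto
    then show ?thesis using f[of i] f[of j] that by cases (auto simp: R_def)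
  qed
  then show ?thesis by (intro exI[of _ "\<lambda>i. fst (f i)"]) blast
qed

section \<open>Thinning out a Miller tree\<close>

text \<open>The nodes \<open>\<phi> n\<close> are indexed by the infinitely branching tree on the natural numbers in
  which the parent of \<open>Suc n\<close> is the first component of \<open>prod_decode n\<close>.\<close>

lemma fst_prod_decode_le: "fst (prod_decode n) \<le> n"
  by (metis le_prod_encode_1 prod.collapse prod_decode_inverse)

text \<open>The parent of \<open>Suc n\<close> is a splitting node built earlier, so it has a
  successor \<open>k\<close> above the finitely many numbers used so far; the new node is a
  splitting node beyond that successor.\<close>

lemma miller_scheme_exists:
  assumes S: "S \<in> miller_trees"
  obtains \<phi> where "\<And>n. \<phi> n \<in> S"
    and "\<And>n. \<exists>k. prefix (\<phi> (fst (prod_decode n)) @ [k]) (\<phi> (Suc n)) \<and>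
             (\<forall>i\<le>n. \<forall>x\<in>set (\<phi> i). x < k)"
proof -
  let ?split = "\<lambda>u. u \<in> S \<and> infinite {k. u @ [k] \<in> S}"
  \<comment> \<open>\<open>?split\<close> belongs to the invariant because every node later acts as
    a parent.\<close>
  define R where "R \<phi> m u \<longleftrightarrow> ?split u \<and>
     (\<forall>n. m = Suc n \<longrightarrow> (\<exists>k. prefix (\<phi> (fst (prod_decode n)) @ [k]) u \<and>
             (\<forall>i\<le>n. \<forall>x\<in>set (\<phi> i). x < k)))" for \<phi> :: "nat \<Rightarrow> nat list" and m u
  have ext: "\<exists>u. ?split u \<and> prefix t u" if "t \<in> S" for t
    using S that unfolding miller_trees_def by blast
  have "\<exists>\<phi>. \<forall>m. R \<phi> m (\<phi> m)"
  proof (rule dependent_wf_choice[OF wf_less_than])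
    fix \<phi> \<psi> :: "nat \<Rightarrow> nat list" and m u
    assume eq: "\<And>i. (i, m) \<in> less_than \<Longrightarrow> \<phi> i = \<psi> i"
    have "\<phi> i = \<psi> i" if "m = Suc n" "i \<le> n" for i n using eq that by simp
    then show "R \<phi> m u = R \<psi> m u"
      unfolding R_def using fst_prod_decode_le by (intro conj_cong refl iff_allI imp_cong) auto
  next
    fix m and \<phi> :: "nat \<Rightarrow> nat list"
    assume IH: "\<And>i. (i, m) \<in> less_than \<Longrightarrow> R \<phi> i (\<phi> i)"
    show "\<exists>u. R \<phi> m u"
    proof (cases m)
      case 0
      have "S \<noteq> {}" using S by (auto simp: miller_trees_def is_tree_def)
      then show ?thesis using ext 0 by (auto simp: R_def)
    next
      case (Suc n)
      let ?v = "\<phi> (fst (prod_decode n))"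
      have "?split ?v" using IH[of "fst (prod_decode n)"] fst_prod_decode_le[of n] Suc
        by (auto simp: R_def)
      moreover have "finite (\<Union>i\<le>n. set (\<phi> i))" by simp
      then obtain b where b: "\<And>i x. i \<le> n \<Longrightarrow> x \<in> set (\<phi> i) \<Longrightarrow> x < b"
        unfolding finite_nat_set_iff_bounded by auto
      ultimately obtain k where k: "k \<ge> b" "?v @ [k] \<in> S"
        by (metis (mono_tags, lifting) infinite_nat_iff_unbounded_le mem_Collect_eq)
      then obtain u where "?split u" "prefix (?v @ [k]) u" using ext by blast
      then have "R \<phi> m u" unfolding R_def using Suc b k by (auto intro: less_le_trans)
      then show ?thesis ..
    qed
  qed
  then obtain \<phi> where \<phi>: "\<And>m. R \<phi> m (\<phi> m)" by blast
  show thesis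
  proof (rule that)
    fix n
    show "\<phi> n \<in> S" using \<phi>[of n] by (simp add: R_def)
    show "\<exists>k. prefix (\<phi> (fst (prod_decode n)) @ [k]) (\<phi> (Suc n)) \<and>
             (\<forall>i\<le>n. \<forall>x\<in>set (\<phi> i). x < k)"
      using \<phi>[of "Suc n"] by (simp add: R_def)
  qed
qed

text \<open>The bound \<open>m \<le> c\<close> makes \<open>thin_index A \<inter> thin_index A'\<close> finite when \<open>A \<inter> A'\<close> is.\<close>

inductive_set thin_index :: "nat set \<Rightarrow> nat set" for A where
  zero: "0 \<in> thin_index A"
| child: "m \<in> thin_index A \<Longrightarrow> c \<in> A \<Longrightarrow> m \<le> c \<Longrightarrow> Suc (prod_encode (m, c)) \<in> thin_index A"

definition thin_tree :: "(nat \<Rightarrow> nat list) \<Rightarrow> nat set \<Rightarrow> nat list set" where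
  "thin_tree \<phi> A = {u. \<exists>n\<in>thin_index A. prefix u (\<phi> n)}"

text \<open>A nonzero index determines its last edge \<open>(m, c)\<close>. If it lies in both sets,
  then \<open>c \<in> A \<inter> A'\<close>, and \<open>m \<le> c\<close> leaves finitely many
  \<open>m\<close> for each such \<open>c\<close>.\<close>

lemma finite_thin_index_Int:
  assumes "finite (A \<inter> A')"
  shows "finite (thin_index A \<inter> thin_index A')"
proof (rule finite_subset)
  have edge: "\<exists>m c. n = Suc (prod_encode (m, c)) \<and> c \<in> C \<and> m \<le> c"
    if "n \<in> thin_index C" "n \<noteq> 0" for n C
    using that by cases auto
  show "thin_index A \<inter> thin_index A' \<subseteq>
      insert 0 ((\<lambda>(c, m). Suc (prod_encode (m, c))) ` Sigma (A \<inter> A') (\<lambda>c. {..c}))"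
  proof
    fix n assume n: "n \<in> thin_index A \<inter> thin_index A'"
    show "n \<in> insert 0 ((\<lambda>(c, m). Suc (prod_encode (m, c))) ` Sigma (A \<inter> A') (\<lambda>c. {..c}))"
    proof (cases "n = 0")
      case False
      obtain m c where "n = Suc (prod_encode (m, c))" "c \<in> A" "m \<le> c"
        using edge[of n A] n False by blast
      moreover from this have "c \<in> A'" using edge[of n A'] n by auto
      ultimately show ?thesis by force
    qed simp
  qed
  show "finite (insert 0 ((\<lambda>(c, m). Suc (prod_encode (m, c))) ` Sigma (A \<inter> A') (\<lambda>c. {..c})))"
    using assms by auto
qed

lemma sorted_wrt_prefix: "sorted_wrt P w \<Longrightarrow> prefix u w \<Longrightarrow> sorted_wrt P u"
  by (auto simp: prefix_def sorted_wrt_append)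

text \<open>Two prefixes of one list are comparable, and in a sorted list the larger entry
  \<open>k\<close> cannot occur up to \<open>x\<close>.\<close>

lemma sorted_prefix_of_less:
  fixes u v w :: "nat list"
  assumes "sorted_wrt (<) w" "prefix (u @ [x]) w" "prefix (v @ [k]) w" "x < k"
  shows "prefix (u @ [x]) v"
proof -
  have "sorted_wrt (<) (u @ [x])" using assms(1,2) by (rule sorted_wrt_prefix)
  then have "\<not> prefix (v @ [k]) (u @ [x])"
    using assms(4) set_mono_prefix[of "v @ [k]" u]
    by (auto simp: sorted_wrt_append dest: less_asym)
  then show ?thesis using prefix_same_cases[OF assms(2,3)] by auto
qed

lemma sorted_prefix_unique:
  fixes u v w :: "nat list"
  assumes "sorted_wrt (<) w" "prefix (u @ [x]) w" "prefix (v @ [x]) w"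
  shows "u = v"
proof -
  have "sorted_wrt (<) (u @ [x])" "sorted_wrt (<) (v @ [x])"
    using assms sorted_wrt_prefix by blast+
  then have "x \<notin> set u" "x \<notin> set v" by (auto simp: sorted_wrt_append)
  then have "\<not> prefix (u @ [x]) v" "\<not> prefix (v @ [x]) u"
    using set_mono_prefix by fastforce+
  then show ?thesis using prefix_same_cases[OF assms(2,3)] by auto
qed

lemma init_seg_Suc: "init_seg f (Suc k) = init_seg f k @ [f k]"
  by (simp add: init_seg_def)

section \<open>Branches of the thinned trees\<close>

locale miller_scheme =
  fixes S :: "nat list set" and \<phi> :: "nat \<Rightarrow> nat list"
  assumes tree: "is_tree S"
    and in_tree: "\<phi> n \<in> S"
    and fresh: "\<exists>k. prefix (\<phi> (fst (prod_decode n)) @ [k]) (\<phi> (Suc n)) \<and>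
             (\<forall>i\<le>n. \<forall>x\<in>set (\<phi> i). x < k)"
begin

lemma sorted: "sorted_wrt (<) (\<phi> n)"
  using tree in_tree[of n] by (auto simp: is_tree_def fin_incr_seqs_def)

text \<open>An entry used before stage \<open>Suc n\<close> is below the fresh number that follows
  the parent, so it must sit inside the parent.\<close>

lemma old_entry_prefix_parent:
  assumes "prefix (u @ [x]) (\<phi> (Suc n))" "x \<in> set (\<phi> m)" "m \<le> n"
  shows "prefix (u @ [x]) (\<phi> (fst (prod_decode n)))"
  using fresh[of n] assms sorted sorted_prefix_of_less by blast

text \<open>An entry determines everything below it throughout the scheme. If the indices differ,
  \<open>x\<close> is old for the larger one, which can therefore be replaced by its parent; this
  descends until the indices agree.\<close>

lemma node_determined_by_last:
  assumes "prefix (u @ [x]) (\<phi> n)" "prefix (v @ [x]) (\<phi> m)"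
  shows "u = v"
  using assms
proof (induction "n + m" arbitrary: n m u v rule: less_induct)
  case less
  have step: "u' = v'" if "n' > m'" "n' + m' = n + m"
    "prefix (u' @ [x]) (\<phi> n')" "prefix (v' @ [x]) (\<phi> m')" for n' m' u' v'
  proof -
    from that(1) obtain l where l: "n' = Suc l" by (cases n') auto
    have "x \<in> set (\<phi> m')" using that(4) by (auto simp: prefix_def)
    then have "prefix (u' @ [x]) (\<phi> (fst (prod_decode l)))"
      using old_entry_prefix_parent that l by simp
    moreover have "fst (prod_decode l) + m' < n + m"
      using fst_prod_decode_le[of l] that l by simp
    ultimately show ?thesis using less.hyps that(4) by blast
  qed
  consider "n = m" | "n > m" | "m > n" by linarith
  then show ?case
  proof cases
    case 1 then show ?thesis using sorted_prefix_unique[OF sorted] less.prems by blast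
  next
    case 2 then show ?thesis using step less.prems by blast
  next
    case 3 then show ?thesis using step[of n m v u] less.prems by (simp add: add.commute)
  qed
qed

text \<open>This attaches to each entry an index that does not depend on \<open>A\<close>. If
  \<open>x\<close> is not new at a node, it already occurs in the parent, whose index is in
  \<open>thin_index A\<close> as well.\<close>

lemma least_index_in_thin_index:
  assumes "n \<in> thin_index A" "prefix (u @ [x]) (\<phi> n)"
  shows "(LEAST m. x \<in> set (\<phi> m)) \<in> thin_index A"
  using assms
proof (induction n)
  case zero
  then have "x \<in> set (\<phi> 0)" by (auto simp: prefix_def)
  then have "(LEAST m. x \<in> set (\<phi> m)) = 0" by (intro Least_equality) auto
  then show ?case by (simp add: thin_index.zero)
next
  case (child m c)
  let ?n = "prod_encode (m, c)" and ?l = "LEAST m. x \<in> set (\<phi> m)"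
  have x: "x \<in> set (\<phi> (Suc ?n))" using child.prems by (auto simp: prefix_def)
  show ?case
  proof (cases "?l = Suc ?n")
    case True
    then show ?thesis using child.hyps thin_index.child by metis
  next
    case False
    have "?l \<le> Suc ?n" using x by (rule Least_le)
    moreover have "x \<in> set (\<phi> ?l)" using x by (rule LeastI)
    ultimately have "prefix (u @ [x]) (\<phi> m)"
      using old_entry_prefix_parent[OF child.prems, of ?l] False by simp
    then show ?thesis by (rule child.IH)
  qed
qed

lemma thin_tree_subset: "thin_tree \<phi> A \<subseteq> S"
  using tree in_tree by (auto simp: thin_tree_def is_tree_def)

text \<open>A selected node \<open>\<phi> m\<close> keeps one child for each
  \<open>c \<in> A\<close> with \<open>m \<le> c\<close>, which omits only finitely many elements of
  \<open>A\<close>. Freshness makes the corresponding successors distinct.\<close>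

lemma thin_tree_miller:
  assumes "infinite A"
  shows "thin_tree \<phi> A \<in> miller_trees"
proof -
  have "is_tree (thin_tree \<phi> A)"
    unfolding is_tree_def
  proof (intro conjI ballI allI impI)
    show "thin_tree \<phi> A \<noteq> {}" using thin_index.zero by (auto simp: thin_tree_def)
    show "thin_tree \<phi> A \<subseteq> fin_incr_seqs"
      using thin_tree_subset tree by (auto simp: is_tree_def)
    fix t u assume "t \<in> thin_tree \<phi> A" "prefix u t"
    then show "u \<in> thin_tree \<phi> A"
      unfolding thin_tree_def by (blast intro: prefix_order.trans)
  qed
  moreover have "infinite {k. \<phi> m @ [k] \<in> thin_tree \<phi> A}" if m: "m \<in> thin_index A" for m
  proof -
    let ?n = "\<lambda>c. prod_encode (m, c)" and ?C = "{c \<in> A. m \<le> c}"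
    have "\<exists>k. prefix (\<phi> m @ [k]) (\<phi> (Suc (?n c))) \<and> (\<forall>i\<le>?n c. \<forall>x\<in>set (\<phi> i). x < k)" for c
      using fresh[of "?n c"] by simp
    then obtain k where k: "\<And>c. prefix (\<phi> m @ [k c]) (\<phi> (Suc (?n c)))"
      "\<And>c i x. i \<le> ?n c \<Longrightarrow> x \<in> set (\<phi> i) \<Longrightarrow> x < k c" by metis
    have less: "k c < k d" if "?n c < ?n d" for c d
    proof -
      have "k c \<in> set (\<phi> (Suc (?n c)))" using k(1)[of c] by (auto simp: prefix_def)
      then show ?thesis using k(2) that by (meson Suc_leI)
    qed
    have "inj k"
    proof (rule injI)
      fix c d assume eq: "k c = k d"
      have "?n c = ?n d" using less[of c d] less[of d c] eq by (cases "?n c" "?n d" rule: linorder_cases) auto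
      then show "c = d" by simp
    qed
    moreover have "infinite ?C"
    proof
      assume "finite ?C"
      moreover have "A \<subseteq> ?C \<union> {..<m}" by auto
      ultimately show False using assms finite_subset by blast
    qed
    ultimately have "infinite (k ` ?C)" using finite_imageD inj_on_subset by blast
    moreover have "k ` ?C \<subseteq> {k. \<phi> m @ [k] \<in> thin_tree \<phi> A}"
      using k(1) m by (auto simp: thin_tree_def intro!: bexI[OF _ thin_index.child])
    ultimately show ?thesis using infinite_super by blast
  qed
  moreover have "\<phi> m \<in> thin_tree \<phi> A" if "m \<in> thin_index A" for m
    using that by (auto simp: thin_tree_def)
  ultimately show ?thesis unfolding miller_trees_def thin_tree_def by blast
qed

lemma branch_node:
  assumes "f \<in> branches (thin_tree \<phi> A)"
  obtains n where "n \<in> thin_index A" "prefix (init_seg f k @ [f k]) (\<phi> n)"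
proof -
  have "init_seg f (Suc k) \<in> thin_tree \<phi> A" using assms by (auto simp: branches_def)
  then show thesis using that by (auto simp: thin_tree_def init_seg_Suc)
qed

text \<open>A common value forces the initial segments before it to coincide, and common values
  occur arbitrarily far out.\<close>

lemma branches_almost_disjoint:
  assumes f: "f \<in> branches (thin_tree \<phi> A)" and g: "g \<in> branches (thin_tree \<phi> A)"
    and inf: "infinite (range f \<inter> range g)"
  shows "f = g"
proof
  fix i
  have "infinite {k. f k \<in> range g}"
  proof
    assume "finite {k. f k \<in> range g}"
    then have "finite (f ` {k. f k \<in> range g})" by simp
    moreover have "f ` {k. f k \<in> range g} = range f \<inter> range g" by auto
    ultimately show False using inf by simp
  qed
  then obtain k where k: "k > i" "f k \<in> range g"
    by (metis (mono_tags, lifting) infinite_nat_iff_unbounded mem_Collect_eq)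
  then obtain l where l: "f k = g l" by auto
  have "init_seg f k = init_seg g l"
    using branch_node[OF f, of k] branch_node[OF g, of l] node_determined_by_last l by metis
  then have eq: "map f [0..<k] = map g [0..<l]" by (simp add: init_seg_def)
  then have "k = l" using map_eq_imp_length_eq by fastforce
  then show "f i = g i" using eq k(1) by simp
qed

text \<open>Every value of a common branch first appears at an index in both
  \<open>thin_index\<close> sets. Only finitely many finite nodes have such indices, whereas a
  branch has infinite range.\<close>

lemma branches_disjoint:
  assumes "finite (A \<inter> A')"
  shows "branches (thin_tree \<phi> A) \<inter> branches (thin_tree \<phi> A') = {}"
proof (rule ccontr)
  assume "\<not> ?thesis"
  then obtain f where f: "f \<in> branches (thin_tree \<phi> A)" "f \<in> branches (thin_tree \<phi> A')"
    by blast
  let ?N = "thin_index A \<inter> thin_index A'"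
  have "range f \<subseteq> (\<Union>n\<in>?N. set (\<phi> n))"
  proof
    fix x assume "x \<in> range f"
    then obtain k where x: "x = f k" by blast
    obtain n where n: "n \<in> thin_index A" "prefix (init_seg f k @ [x]) (\<phi> n)"
      using branch_node[OF f(1)] x by blast
    obtain n' where n': "n' \<in> thin_index A'" "prefix (init_seg f k @ [x]) (\<phi> n')"
      using branch_node[OF f(2)] x by blast
    have "x \<in> set (\<phi> n)" using n by (auto simp: prefix_def)
    then have "x \<in> set (\<phi> (LEAST m. x \<in> set (\<phi> m)))" by (rule LeastI)
    moreover have "(LEAST m. x \<in> set (\<phi> m)) \<in> ?N"
      using least_index_in_thin_index n n' by blast
    ultimately show "x \<in> (\<Union>n\<in>?N. set (\<phi> n))" by blast
  qed
  moreover have "finite (\<Union>n\<in>?N. set (\<phi> n))" using finite_thin_index_Int[OF assms] by simp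
  ultimately have "finite (range f)" by (rule finite_subset)
  moreover have "inj f" using f(1) by (auto simp: branches_def inf_incr_seqs_def strict_mono_imp_inj_on)
  ultimately show False using range_inj_infinite by blast
qed

end

section \<open>An almost disjoint family of size continuum\<close>

text \<open>The branch of the full binary tree given by \<open>z\<close>, with nodes coded as
  numbers. Coding the length \<open>j\<close> along with the trace keeps the set infinite even for
  finite \<open>z\<close>.\<close>

definition trace_codes :: "nat set \<Rightarrow> nat set" where
  "trace_codes z = range (\<lambda>j. prod_encode (j, set_encode (z \<inter> {..<j})))"

lemma infinite_trace_codes: "infinite (trace_codes z)"
  unfolding trace_codes_def by (rule range_inj_infinite) (auto intro!: injI)

lemma finite_trace_codes_Int:
  assumes "z \<noteq> z'"
  shows "finite (trace_codes z \<inter> trace_codes z')"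
proof -
  obtain i where i: "i \<in> z \<longleftrightarrow> i \<notin> z'" using assms by blast
  have "trace_codes z \<inter> trace_codes z' \<subseteq> (\<lambda>j. prod_encode (j, set_encode (z \<inter> {..<j}))) ` {..i}"
  proof
    fix c assume "c \<in> trace_codes z \<inter> trace_codes z'"
    \<comment> \<open>Both representations of \<open>c\<close> have the same length
      \<open>j\<close>, so the two traces agree, which fails as soon as \<open>j\<close> exceeds
      \<open>i\<close>.\<close>
    then obtain j where j: "c = prod_encode (j, set_encode (z \<inter> {..<j}))"
      "set_encode (z \<inter> {..<j}) = set_encode (z' \<inter> {..<j})"
      by (auto simp: trace_codes_def)
    then have "z \<inter> {..<j} = z' \<inter> {..<j}" by (simp add: set_encode_eq)
    then have "j \<le> i" using i by (metis IntD1 IntI lessThan_iff not_le_imp_less)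
    then show "c \<in> (\<lambda>j. prod_encode (j, set_encode (z \<inter> {..<j}))) ` {..i}" using j(1) by blast
  qed
  then show ?thesis using finite_subset by blast
qed

lemma miller_disjoint_refinements:
  assumes S: "S \<in> miller_trees"
  obtains Q where "\<And>z :: nat set. Q z \<in> miller_trees" "\<And>z. Q z \<subseteq> S"
    and "\<And>z z'. z \<noteq> z' \<Longrightarrow> branches (Q z) \<inter> branches (Q z') = {}"
    and "\<And>z f g. f \<in> branches (Q z) \<Longrightarrow> g \<in> branches (Q z) \<Longrightarrow>
      infinite (range f \<inter> range g) \<Longrightarrow> f = g"
proof -
  obtain \<phi> where "\<And>n. \<phi> n \<in> S"
    "\<And>n. \<exists>k. prefix (\<phi> (fst (prod_decode n)) @ [k]) (\<phi> (Suc n)) \<and>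
             (\<forall>i\<le>n. \<forall>x\<in>set (\<phi> i). x < k)"
    using miller_scheme_exists[OF S] by blast
  then interpret miller_scheme S \<phi>
    using S by unfold_locales (auto simp: miller_trees_def)
  show thesis
  proof (rule that)
    fix z z' :: "nat set" and f g
    show "thin_tree \<phi> (trace_codes z) \<in> miller_trees"
      by (rule thin_tree_miller[OF infinite_trace_codes])
    show "thin_tree \<phi> (trace_codes z) \<subseteq> S" by (rule thin_tree_subset)
    show "branches (thin_tree \<phi> (trace_codes z)) \<inter> branches (thin_tree \<phi> (trace_codes z')) = {}"
      if "z \<noteq> z'" by (rule branches_disjoint[OF finite_trace_codes_Int[OF that]])
    show "f = g" if "f \<in> branches (thin_tree \<phi> (trace_codes z))"
      "g \<in> branches (thin_tree \<phi> (trace_codes z))" "infinite (range f \<inter> range g)"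
      using that by (rule branches_almost_disjoint)
  qed
qed

section \<open>Branches of Matet trees\<close>

lemma matet_block_less:
  assumes "matet_data s a" "x \<in> a m" "y \<in> a n" "m < n"
  shows "x < y"
  using assms(4,3)
proof (induction n arbitrary: y)
  case (Suc n)
  have fin: "finite (a i)" "a i \<noteq> {}" for i using assms(1) by (auto simp: matet_data_def)
  have "x \<le> Max (a n)"
  proof (cases "m = n")
    case True then show ?thesis using fin assms(2) by simp
  next
    case False
    then show ?thesis using Suc fin Max_in[of "a n"] by (simp add: less_imp_le)
  qed
  also have "Max (a n) < Min (a (Suc n))" using assms(1) by (auto simp: matet_data_def)
  also have "\<dots> \<le> y" using fin Suc.prems by simp
  finally show ?case .
qed simp

lemma matet_stem_less:
  assumes "matet_data s a" "x \<in> s" "y \<in> a n"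
  shows "x < y"
proof -
  have fin: "finite s" "\<And>i. finite (a i)" "\<And>i. a i \<noteq> {}" using assms(1) by (auto simp: matet_data_def)
  have "x \<le> Max s" using fin assms by simp
  also have "Max s < Min (a 0)" using assms by (auto simp: matet_data_def)
  also have "Min (a 0) \<le> y"
    using matet_block_less[OF assms(1) _ assms(3), of "Min (a 0)" 0] fin assms(3)
    by (cases "n = 0") (auto intro: less_imp_le)
  finally show ?thesis .
qed

text \<open>Stem and blocks are pairwise disjoint, so the minima of the blocks recover
  \<open>B\<close> from the union. This yields injectivity of the branches chosen in a Matet
  tree.\<close>

lemma Min_block_mem_iff:
  assumes "matet_data s a"
  shows "Min (a n) \<in> s \<union> (\<Union>m\<in>B. a m) \<longleftrightarrow> n \<in> B"
proof -
  have mem: "Min (a n) \<in> a n" using assms by (auto simp: matet_data_def)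
  have "Min (a n) \<notin> s" using matet_stem_less[OF assms _ mem] by blast
  moreover have "Min (a n) \<in> a m \<longleftrightarrow> m = n" for m
    using matet_block_less[OF assms mem, of "Min (a n)" m]
      matet_block_less[OF assms _ mem, of "Min (a n)" m] mem
    by (cases m n rule: linorder_cases) auto
  ultimately show ?thesis by simp
qed

lemma infinite_matet_blocks:
  assumes "matet_data s a" "infinite B"
  shows "infinite (\<Union>n\<in>B. a n)"
proof -
  have mem: "Min (a n) \<in> a n" for n using assms(1) by (auto simp: matet_data_def)
  have "inj (\<lambda>n. Min (a n))"
    using matet_block_less[OF assms(1) mem mem]
    by (metis (no_types, lifting) injI less_irrefl linorder_neqE_nat)
  then have "infinite ((\<lambda>n. Min (a n)) ` B)"
    using assms(2) finite_imageD inj_on_subset by blast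
  moreover have "(\<lambda>n. Min (a n)) ` B \<subseteq> (\<Union>n\<in>B. a n)" using mem by blast
  ultimately show ?thesis using infinite_super by blast
qed

lemma matet_branches:
  assumes T: "T \<in> matet_trees"
  obtains q where "\<And>w :: nat set. q w \<in> branches T" "inj q"
    and "\<And>w w'. infinite (range (q w) \<inter> range (q w'))"
proof -
  obtain s a where d: "matet_data s a" and T': "T = matet_tree s a"
    using T by (auto simp: matet_trees_def)
  define D where "D w = range (\<lambda>n. 2 * n) \<union> (\<lambda>n. 2 * n + 1) ` w" for w :: "nat set"
  define U where "U B = s \<union> (\<Union>n\<in>B. a n)" for B
  have evens: "infinite (range (\<lambda>n::nat. 2 * n))" by (rule range_inj_infinite) (auto intro: injI)
  have infD: "infinite (D w)" for w using evens by (simp add: D_def)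
  have infU: "infinite (U (D w))" for w
    using infinite_matet_blocks[OF d infD] by (simp add: U_def)
  have rng: "range (enumerate (U (D w))) = U (D w)" for w using range_enumerate[OF infU] .
  show thesis
  proof (rule that)
    fix w w' :: "nat set"
    show "enumerate (U (D w)) \<in> branches T"
      using strict_mono_enumerate[OF infU] infD
      by (auto simp: branches_def inf_incr_seqs_def T' matet_tree_def U_def)
    have "infinite (\<Union>n\<in>range (\<lambda>n. 2 * n). a n)" using infinite_matet_blocks[OF d evens] .
    moreover have "(\<Union>n\<in>range (\<lambda>n. 2 * n). a n) \<subseteq> U (D w) \<inter> U (D w')"
      by (auto simp: U_def D_def)
    ultimately show "infinite (range (enumerate (U (D w))) \<inter> range (enumerate (U (D w'))))"
      unfolding rng using infinite_super by blast
  next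
    show "inj (\<lambda>w. enumerate (U (D w)))"
    proof (rule injI)
      fix w w' assume "enumerate (U (D w)) = enumerate (U (D w'))"
      then have "U (D w) = U (D w')" using rng by metis
      then have "n \<in> D w \<longleftrightarrow> n \<in> D w'" for n
        using Min_block_mem_iff[OF d] unfolding U_def by metis
      moreover have "2 * n + 1 \<in> D v \<longleftrightarrow> n \<in> v" for n v by (auto simp: D_def Suc_double_not_eq_double)
      ultimately show "w = w'" by blast
    qed
  qed
qed

section \<open>Construction of the separating set\<close>

text \<open>If there were no Matet trees, membership in \<open>t0\<close> would hold vacuously for
  all subsets of \<open>inf_incr_seqs\<close>.\<close>

lemma matet_trees_nonempty: "matet_trees \<noteq> {}"
proof -
  have "matet_data {} (\<lambda>n. {n})" by (simp add: matet_data_def)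
  then show ?thesis by (auto simp: matet_trees_def)
qed

theorem theorem2p6:
  "\<exists>X. X \<subseteq> inf_incr_seqs \<and> X \<in> m0 \<and> X \<notin> t0"
proof -
  have "\<exists>R. (\<forall>z :: nat set. R z \<in> miller_trees \<and> R z \<subseteq> S) \<and>
      (\<forall>z z'. z \<noteq> z' \<longrightarrow> branches (R z) \<inter> branches (R z') = {}) \<and>
      (\<forall>z f g. f \<in> branches (R z) \<longrightarrow> g \<in> branches (R z) \<longrightarrow>
        infinite (range f \<inter> range g) \<longrightarrow> f = g)" (is "\<exists>R. ?good S R")
    if "S \<in> miller_trees" for S
    by (rule miller_disjoint_refinements[OF that], rule exI, intro conjI allI impI) assumption+
  then have "\<forall>S\<in>miller_trees. \<exists>R. ?good S R" by (rule ballI)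
  then obtain Q where "\<forall>S\<in>miller_trees. ?good S (Q S)" by (rule bchoice[THEN exE])
  then have Q: "\<And>S z. S \<in> miller_trees \<Longrightarrow> Q S z \<in> miller_trees \<and> Q S z \<subseteq> S"
    "\<And>S z z'. S \<in> miller_trees \<Longrightarrow> z \<noteq> z' \<Longrightarrow> branches (Q S z) \<inter> branches (Q S z') = {}"
    "\<And>S z f g. S \<in> miller_trees \<Longrightarrow> f \<in> branches (Q S z) \<Longrightarrow> g \<in> branches (Q S z) \<Longrightarrow>
        infinite (range f \<inter> range g) \<Longrightarrow> f = g"
    by simp_all
  have "\<exists>p. (\<forall>w :: nat set. p w \<in> branches T) \<and> inj p \<and>
      (\<forall>w w'. infinite (range (p w) \<inter> range (p w')))" (is "\<exists>p. ?good T p")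
    if "T \<in> matet_trees" for T
    by (rule matet_branches[OF that], rule exI, intro conjI allI) assumption+
  then have "\<forall>T\<in>matet_trees. \<exists>p. ?good T p" by (rule ballI)
  then obtain q where "\<forall>T\<in>matet_trees. ?good T (q T)" by (rule bchoice[THEN exE])
  then have q: "\<And>T w. T \<in> matet_trees \<Longrightarrow> q T w \<in> branches T"
    "\<And>T. T \<in> matet_trees \<Longrightarrow> inj (q T)"
    "\<And>T w w'. T \<in> matet_trees \<Longrightarrow> infinite (range (q T w) \<inter> range (q T w'))"
    by simp_all
  \<comment> \<open>The recursion wants trees and parameters in one type, namely
    \<open>nat list set\<close>; \<open>h\<close> injects it into the parameter type of
    \<open>q\<close> and \<open>Q\<close>.\<close>
  define h :: "nat list set \<Rightarrow> nat set" where "h = image to_nat"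
  have h: "inj h" unfolding h_def by (simp add: inj_image_eq_iff inj_on_def)
  have "infinite (UNIV :: nat list set set)"
    by (simp add: Finite_Set.finite_set infinite_UNIV_listI)
  then have "\<exists>c. \<forall>S\<in>miller_trees. \<exists>z. \<forall>T\<in>matet_trees. q T (h (c T)) \<notin> branches (Q S (h z))"
  proof (rule bernstein_recursion)
    fix S and z z' :: "nat list set" assume "S \<in> miller_trees" "z \<noteq> z'"
    then show "branches (Q S (h z)) \<inter> branches (Q S (h z')) = {}"
      using Q(2) h by (simp add: inj_eq)
  next
    fix T S and z w w' :: "nat list set"
    assume "T \<in> matet_trees" "S \<in> miller_trees"
      "q T (h w) \<in> branches (Q S (h z))" "q T (h w') \<in> branches (Q S (h z))"
    \<comment> \<open>Chosen branches of one Matet tree meet infinitely often, whereas distinct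
      branches of one thinned Miller tree do not.\<close>
    then have "q T (h w) = q T (h w')" using Q(3) q(3) by blast
    then show "w = w'" using q(2) h \<open>T \<in> matet_trees\<close> by (simp add: inj_eq)
  qed
  then obtain c where c: "\<And>S. S \<in> miller_trees \<Longrightarrow>
      \<exists>z. \<forall>T\<in>matet_trees. q T (h (c T)) \<notin> branches (Q S (h z))"
    by blast
  define X where "X = (\<lambda>T. q T (h (c T))) ` matet_trees"
  have sub: "X \<subseteq> inf_incr_seqs" using q(1) by (auto simp: X_def branches_def)
  have "X \<in> m0"
    unfolding m0_def tree_ideal_def
  proof (intro CollectI conjI ballI sub)
    fix S assume S: "S \<in> miller_trees"
    then obtain z where "branches (Q S (h z)) \<inter> X = {}" using c[OF S] by (auto simp: X_def)
    then show "\<exists>T'\<in>miller_trees. T' \<subseteq> S \<and> branches T' \<inter> X = {}" using Q(1)[OF S] by blast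
  qed
  moreover have "X \<notin> t0"
  proof
    \<comment> \<open>Some Matet tree would have no branch in \<open>X\<close>, but \<open>X\<close>
      contains a branch of each.\<close>
    assume "X \<in> t0"
    then obtain T where "T \<in> matet_trees" "branches T \<inter> X = {}"
      using matet_trees_nonempty unfolding t0_def tree_ideal_def by blast
    then show False using q(1) by (auto simp: X_def)
  qed
  ultimately show ?thesis using sub by blast
qed

end
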